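(* Let $X$ be a finite topological space and let $A\subset X$. Then the interior of $A$ is $$\operatorname{int} A=\{a\in A : \text{for every } b\in X \text{ with } b\geq a \text{ one has } b\in A\}.$$
   Context: For a point $x$ of a finite topological space $X$, $U_x$ denotes the intersection of all open sets containing $x$, i.e. the smallest open set containing $x$. For $x,y\in X$ one writes $y\geq x$ (equivalently $x\leq y$) if $U_y\subseteq U_x$. *)

theory Defs
  imports "HOL-Analysis.Abstract_Topology"
begin

text \<open>The set $U_x$. It is meaningful only for points of the space: for \<open>x \<notin> topspace X\<close> the
  intersected family is empty, so the result is \<open>UNIV\<close>.\<close>

definition min_open :: "'a topology \<Rightarrow> 'a \<Rightarrow> 'a set" where
  "min_open X x = \<Inter>{U. openin X U \<and> x \<in> U}"

text \<open>\<open>point_le X x y\<close> is $x \leq y$ (equivalently $y \geq x$). With this convention larger points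
  have smaller minimal open sets, and open sets are the up-sets.\<close>

definition point_le :: "'a topology \<Rightarrow> 'a \<Rightarrow> 'a \<Rightarrow> bool" where
  "point_le X x y \<longleftrightarrow> min_open X y \<subseteq> min_open X x"

end

theory Submission
  imports Defs
begin

text \<open>In a finite space only finitely many open sets contain \<open>x\<close>, and the whole
  space is one of them, so their intersection \<open>min_open X x\<close> is itself open: it is the
  least open neighbourhood of \<open>x\<close>. Hence a point \<open>a\<close> of \<open>A\<close>
  is interior exactly when \<open>min_open X a\<close> lies inside \<open>A\<close>. By
  \<open>point_le_iff_mem_min_open\<close> this neighbourhood is the set of points above
  \<open>a\<close>, which turns the inclusion into the stated order condition.\<close>

lemma openin_min_open:
  assumes "finite (topspace X)" "x \<in> topspace X"
  shows "openin X (min_open X x)"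
proof -
  have "{U. openin X U \<and> x \<in> U} \<subseteq> Pow (topspace X)"
    using openin_subset by blast
  then have "finite {U. openin X U \<and> x \<in> U}"
    using assms(1) finite_subset by blast
  moreover have "topspace X \<in> {U. openin X U \<and> x \<in> U}"
    using assms(2) by simp
  ultimately show ?thesis
    unfolding min_open_def by (intro openin_Inter) auto
qed

lemma mem_min_open_self: "x \<in> min_open X x"
  by (simp add: min_open_def)

lemma min_open_subset:
  assumes "openin X U" "x \<in> U"
  shows "min_open X x \<subseteq> U"
  using assms by (auto simp: min_open_def)

text \<open>If \<open>y\<close> lies in the open set \<open>min_open X x\<close>, minimality at
  \<open>y\<close> gives the inclusion; conversely \<open>y\<close> always lies in its own
  \<open>min_open X y\<close>. The point \<open>y\<close> may be arbitrary: outside the space both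
  sides are false.\<close>

lemma point_le_iff_mem_min_open:
  assumes "finite (topspace X)" "x \<in> topspace X"
  shows "point_le X x y \<longleftrightarrow> y \<in> min_open X x"
  using min_open_subset[OF openin_min_open[OF assms]] mem_min_open_self[of y X]
  by (auto simp: point_le_def)

theorem proposition3p2:
  fixes X :: "'a topology" and A :: "'a set"
  assumes "finite (topspace X)"
    and "A \<subseteq> topspace X"
  shows "X interior_of A = {a \<in> A. \<forall>b\<in>topspace X. point_le X a b \<longrightarrow> b \<in> A}"
proof -
  have "a \<in> X interior_of A \<longleftrightarrow> (\<forall>b\<in>topspace X. point_le X a b \<longrightarrow> b \<in> A)"
    if "a \<in> A" for a
  proof -
    have a: "a \<in> topspace X"
      using that assms(2) by blast
    note op = openin_min_open[OF assms(1) a]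
    have "a \<in> X interior_of A \<longleftrightarrow> min_open X a \<subseteq> A"
    proof
      assume "a \<in> X interior_of A"
      from min_open_subset[OF openin_interior_of this] interior_of_subset
      show "min_open X a \<subseteq> A"
        by (rule subset_trans)
    next
      assume "min_open X a \<subseteq> A"
      from interior_of_maximal[OF this op] mem_min_open_self
      show "a \<in> X interior_of A"
        by (rule subsetD)
    qed
    \<comment> \<open>Since \<open>min_open X a\<close> lies within the space, letting
      \<open>b\<close> range over \<open>topspace X\<close> misses none of its points.\<close>
    then show ?thesis
      using openin_subset[OF op] by (auto simp: point_le_iff_mem_min_open[OF assms(1) a])
  qed
  then show ?thesis
    using interior_of_subset[of X A] by blast
qed

end
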